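(* Let $\mathcal{B}$ be a category and let $F:\mathcal{D}\to\mathcal{E}$ be a concrete functor between concrete categories over $\mathcal{B}$. Then $F$ is initially dense (resp. finally dense) if, and only if, the corresponding $\mathcal{Q}_{\mathcal{B}}$-functor $\overline{F}:\overline{\mathcal{D}}\to\overline{\mathcal{E}}$ is codense (resp. dense).
   Context: Conventions: classes may be large; $\mathcal{B}$ is a (locally small) base category. Concrete categories. A concrete category $\mathcal{E}$ over $\mathcal{B}$ (a faithful functor $|\text{-}|:\mathcal{E}\to\mathcal{B}$, with $\mathcal{E}(X,Y)$ identified with its image) is given by a class $\mathcal{E}_0$ of objects, a function $|\text{-}|:\mathcal{E}_0\to\mathcal{B}_0$, and subsets $\mathcal{E}(X,Y)\subseteq\mathcal{B}(|X|,|Y|)$ with $1_{|X|}\in\mathcal{E}(X,X)$ and $\mathcal{E}(Y,Z)\circ\mathcal{E}(X,Y)\subseteq\mathcal{E}(X,Z)$. A map $f\in\mathcal{B}(|X|,|Y|)$ is an $\mathcal{E}$-morphism if $f\in\mathcal{E}(X,Y)$. A concrete functor $F:\mathcal{D}\to\mathcal{E}$ is a function $F:\mathcal{D}_0\to\mathcal{E}_0$ with $|FX|=|X|$ and $\mathcal{D}(X,Y)\subseteq\mathcal{E}(FX,FY)$. Initial sources and final sinks. A (possibly large) family of $\mathcal{E}$-morphisms $(g_i:Y\to X_i)_{i\in I}$ is an initial source if for any $Z\in\mathcal{E}_0$, a map $f:|Z|\to|Y|$ is an $\mathcal{E}$-morphism as soon as all $g_i\circ f$ are $\mathcal{E}$-morphisms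 $Z\to X_i$. A family of $\mathcal{E}$-morphisms $(f_i:X_i\to Y)_{i\in I}$ is a final sink if for any $Z\in\mathcal{E}_0$, a map $g:|Y|\to|Z|$ is an $\mathcal{E}$-morphism as soon as all $g\circ f_i$ are $\mathcal{E}$-morphisms $X_i\to Z$. A concrete functor $F:\mathcal{D}\to\mathcal{E}$ is initially dense (resp. finally dense) if every $Y\in\mathcal{E}_0$ is the domain (resp. codomain) of some initial source $(g_i:Y\to FX_i)_{i\in I}$ (resp. final sink $(f_i:FX_i\to Y)_{i\in I}$) in $\mathcal{E}$ with $X_i\in\mathcal{D}_0$ for all $i\in I$. Quantaloids. A quantaloid $\mathcal{Q}$ is a (possibly large) 2-category whose 2-cells are given by order, such that each hom-set $\mathcal{Q}(S,T)$ is a complete lattice and composition preserves joins in each variable. Left and right implications are defined by $v\circ u\le w\iff v\le w\swarrow u\iff u\le v\searrow w$ for $u:S\to T$, $v:T\to U$, $w:S\to U$. The free quantaloid $\mathcal{Q}_{\mathcal{B}}$ has the objects of $\mathcal{B}$, $\mathcal{Q}_{\mathcal{B}}(S,T)$ is the powerset of $\mathcal{B}(S,T)$ ordered by inclusion, $\mathbf{g}\circ\mathbf{f}=\{g\circ f\mid f\in\mathbf{f},g\in\mathbf{g}\}$, and identities $\{1_S\}$. $\mathcal{Q}$-categories. A $\mathcal{Q}$-category $\mathcal{E}$ has a class $\mathcal{E}_0$ of objects, an extent function $|\text{-}|:\mathcal{E}_0\to\mathcal{Q}_0$ (where $\mathcal{Q}_0=\mathrm{ob}\,\mathcal{Q}$),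 and $\mathcal{E}(X,Y)\in\mathcal{Q}(|X|,|Y|)$ with $1_{|X|}\le\mathcal{E}(X,X)$ and $\mathcal{E}(Y,Z)\circ\mathcal{E}(X,Y)\le\mathcal{E}(X,Z)$. A $\mathcal{Q}$-functor $F:\mathcal{D}\to\mathcal{E}$ is a function $F:\mathcal{D}_0\to\mathcal{E}_0$ with $|FX|=|X|$ and $\mathcal{D}(X,Y)\le\mathcal{E}(FX,FY)$. Concrete categories and concrete functors over $\mathcal{B}$ are the same data as $\mathcal{Q}_{\mathcal{B}}$-categories and $\mathcal{Q}_{\mathcal{B}}$-functors; $\overline{\mathcal{E}}$ and $\overline{F}$ denote the $\mathcal{Q}_{\mathcal{B}}$-category and $\mathcal{Q}_{\mathcal{B}}$-functor corresponding to $\mathcal{E}$ and $F$. (Co)density. A sink $\sigma$ (resp. source $\tau$) of extent $T\in\mathcal{Q}_0$ on a $\mathcal{Q}$-category $\mathcal{D}$ is a family of $\mathcal{Q}$-arrows $\sigma(X):|X|\to T$ (resp. $\tau(X):T\to|X|$), $X\in\mathcal{D}_0$. For a $\mathcal{Q}$-functor $F:\mathcal{D}\to\mathcal{E}$, an object $C\in\mathcal{E}_0$ of extent $T$ is the colimit $\mathrm{colim}_\sigma F$ (resp. limit $\lim_\tau F$) if for all $Y\in\mathcal{E}_0$, $\mathcal{E}(C,Y)=\bigwedge_{X\in\mathcal{D}_0}\mathcal{E}(FX,Y)\swarrow\sigma(X)$ (resp. $\mathcal{E}(Y,C)=\bigwedge_{X\in\mathcal{D}_0}\tau(X)\searrow\mathcal{E}(Y,FX)$).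 $F$ is dense (resp. codense) if every object of $\mathcal{E}$ is the colimit (resp. limit) of $F$ weighted by some sink (resp. source) on $\mathcal{D}$. *)

theory Defs
  imports "HOL-Algebra.Complete_Lattice"
begin

section \<open>Categories\<close>

text \<open>
  A category is given by a class of objects and a family of hom-sets indexed by pairs of objects.
  Hom-sets over different pairs of objects need not be disjoint as HOL sets (the empty set
  lies in every hom-set of a free quantaloid), so composition takes the three objects involved as
  arguments: \<open>cmp C S T U g f\<close> is the composite of \<open>f : S \<rightarrow> T\<close> and \<open>g : T \<rightarrow> U\<close>.
  The sets of a HOL type play the role of classes, so no size condition occurs.
\<close>

record ('o, 'a) cat =
  ob :: "'o set"
  homs :: "'o \<Rightarrow> 'o \<Rightarrow> 'a set"
  idt :: "'o \<Rightarrow> 'a"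
  cmp :: "'o \<Rightarrow> 'o \<Rightarrow> 'o \<Rightarrow> 'a \<Rightarrow> 'a \<Rightarrow> 'a"

locale category =
  fixes C :: "('o, 'a, 'z) cat_scheme"
  assumes idt_closed: "S \<in> ob C \<Longrightarrow> idt C S \<in> homs C S S"
    and cmp_closed: "\<lbrakk>S \<in> ob C; T \<in> ob C; U \<in> ob C; f \<in> homs C S T; g \<in> homs C T U\<rbrakk>
      \<Longrightarrow> cmp C S T U g f \<in> homs C S U"
    and idt_right: "\<lbrakk>S \<in> ob C; T \<in> ob C; f \<in> homs C S T\<rbrakk> \<Longrightarrow> cmp C S S T f (idt C S) = f"
    and idt_left: "\<lbrakk>S \<in> ob C; T \<in> ob C; f \<in> homs C S T\<rbrakk> \<Longrightarrow> cmp C S T T (idt C T) f = f"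
    and cmp_assoc: "\<lbrakk>S \<in> ob C; T \<in> ob C; U \<in> ob C; V \<in> ob C;
      f \<in> homs C S T; g \<in> homs C T U; h \<in> homs C U V\<rbrakk>
      \<Longrightarrow> cmp C S T V (cmp C T U V h g) f = cmp C S U V h (cmp C S T U g f)"


section \<open>Concrete categories over a base category\<close>

record ('e, 'o, 'a) concrete_cat =
  cob :: "'e set"
  cext :: "'e \<Rightarrow> 'o"
  cmor :: "'e \<Rightarrow> 'e \<Rightarrow> 'a set"

locale concrete_category = category B
  for B :: "('o, 'a) cat" and E :: "('e, 'o, 'a) concrete_cat" +
  assumes cext_closed: "X \<in> cob E \<Longrightarrow> cext E X \<in> ob B"
    and cmor_subset: "\<lbrakk>X \<in> cob E; Y \<in> cob E\<rbrakk> \<Longrightarrow> cmor E X Y \<subseteq> homs B (cext E X) (cext E Y)"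
    and cmor_idt: "X \<in> cob E \<Longrightarrow> idt B (cext E X) \<in> cmor E X X"
    and cmor_cmp: "\<lbrakk>X \<in> cob E; Y \<in> cob E; Z \<in> cob E; f \<in> cmor E X Y; g \<in> cmor E Y Z\<rbrakk>
      \<Longrightarrow> cmp B (cext E X) (cext E Y) (cext E Z) g f \<in> cmor E X Z"

definition concrete_functor ::
  "('d, 'o, 'a) concrete_cat \<Rightarrow> ('e, 'o, 'a) concrete_cat \<Rightarrow> ('d \<Rightarrow> 'e) \<Rightarrow> bool" where
  "concrete_functor D E F \<longleftrightarrow>
    (\<forall>X\<in>cob D. F X \<in> cob E \<and> cext E (F X) = cext D X) \<and>
    (\<forall>X\<in>cob D. \<forall>Y\<in>cob D. cmor D X Y \<subseteq> cmor E (F X) (F Y))"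

definition initial_source ::
  "('o, 'a) cat \<Rightarrow> ('e, 'o, 'a) concrete_cat \<Rightarrow> 'e \<Rightarrow> 'i set \<Rightarrow> ('i \<Rightarrow> 'e) \<Rightarrow> ('i \<Rightarrow> 'a) \<Rightarrow> bool" where
  "initial_source B E Y I X g \<longleftrightarrow>
    Y \<in> cob E \<and> (\<forall>i\<in>I. X i \<in> cob E \<and> g i \<in> cmor E Y (X i)) \<and>
    (\<forall>Z\<in>cob E. \<forall>f\<in>homs B (cext E Z) (cext E Y).
      (\<forall>i\<in>I. cmp B (cext E Z) (cext E Y) (cext E (X i)) (g i) f \<in> cmor E Z (X i))
      \<longrightarrow> f \<in> cmor E Z Y)"

definition final_sink ::
  "('o, 'a) cat \<Rightarrow> ('e, 'o, 'a) concrete_cat \<Rightarrow> 'e \<Rightarrow> 'i set \<Rightarrow> ('i \<Rightarrow> 'e) \<Rightarrow> ('i \<Rightarrow> 'a) \<Rightarrow> bool" where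
  "final_sink B E Y I X f \<longleftrightarrow>
    Y \<in> cob E \<and> (\<forall>i\<in>I. X i \<in> cob E \<and> f i \<in> cmor E (X i) Y) \<and>
    (\<forall>Z\<in>cob E. \<forall>g\<in>homs B (cext E Y) (cext E Z).
      (\<forall>i\<in>I. cmp B (cext E (X i)) (cext E Y) (cext E Z) g (f i) \<in> cmor E (X i) Z)
      \<longrightarrow> g \<in> cmor E Y Z)"

text \<open>
  HOL cannot quantify over the type of indices inside a formula.  The families below are indexed by
  arbitrary subsets of \<open>'d \<times> 'a\<close>; the lemmas \<open>initially_denseI\<close> and \<open>finally_denseI\<close> show that
  this is general enough: families indexed by subsets of any other type yield nothing more.
\<close>

definition initially_dense :: "('o, 'a) cat \<Rightarrow> ('d, 'o, 'a) concrete_cat \<Rightarrow>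
    ('e, 'o, 'a) concrete_cat \<Rightarrow> ('d \<Rightarrow> 'e) \<Rightarrow> bool" where
  "initially_dense B D E F \<longleftrightarrow>
    (\<forall>Y\<in>cob E. \<exists>(I :: ('d \<times> 'a) set) X g.
      (\<forall>i\<in>I. X i \<in> cob D) \<and> initial_source B E Y I (\<lambda>i. F (X i)) g)"

definition finally_dense :: "('o, 'a) cat \<Rightarrow> ('d, 'o, 'a) concrete_cat \<Rightarrow>
    ('e, 'o, 'a) concrete_cat \<Rightarrow> ('d \<Rightarrow> 'e) \<Rightarrow> bool" where
  "finally_dense B D E F \<longleftrightarrow>
    (\<forall>Y\<in>cob E. \<exists>(I :: ('d \<times> 'a) set) X f.
      (\<forall>i\<in>I. X i \<in> cob D) \<and> final_sink B E Y I (\<lambda>i. F (X i)) f)"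

lemma initially_denseI:
  fixes B :: "('o, 'a) cat" and F :: "'d \<Rightarrow> 'e"
  assumes "\<And>Y. Y \<in> cob E \<Longrightarrow> \<exists>(I :: 'i set) X g.
      (\<forall>i\<in>I. X i \<in> cob D) \<and> initial_source B E Y I (\<lambda>i. F (X i)) g"
  shows "initially_dense B D E F"
  unfolding initially_dense_def
proof
  fix Y assume "Y \<in> cob E"
  then obtain I :: "'i set" and X g where
    *: "\<forall>i\<in>I. X i \<in> cob D" "initial_source B E Y I (\<lambda>i. F (X i)) g"
    using assms[OF \<open>Y \<in> cob E\<close>] by (elim exE conjE)
  have "(\<forall>p\<in>(\<lambda>i. (X i, g i)) ` I. fst p \<in> cob D) \<and>
      initial_source B E Y ((\<lambda>i. (X i, g i)) ` I) (\<lambda>p. F (fst p)) snd"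
    using * unfolding initial_source_def by simp
  then show "\<exists>(I :: ('d \<times> 'a) set) X g.
      (\<forall>i\<in>I. X i \<in> cob D) \<and> initial_source B E Y I (\<lambda>i. F (X i)) g"
    by blast
qed

lemma finally_denseI:
  fixes B :: "('o, 'a) cat" and F :: "'d \<Rightarrow> 'e"
  assumes "\<And>Y. Y \<in> cob E \<Longrightarrow> \<exists>(I :: 'i set) X f.
      (\<forall>i\<in>I. X i \<in> cob D) \<and> final_sink B E Y I (\<lambda>i. F (X i)) f"
  shows "finally_dense B D E F"
  unfolding finally_dense_def
proof
  fix Y assume "Y \<in> cob E"
  then obtain I :: "'i set" and X f where
    *: "\<forall>i\<in>I. X i \<in> cob D" "final_sink B E Y I (\<lambda>i. F (X i)) f"
    using assms[OF \<open>Y \<in> cob E\<close>] by (elim exE conjE)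
  have "(\<forall>p\<in>(\<lambda>i. (X i, f i)) ` I. fst p \<in> cob D) \<and>
      final_sink B E Y ((\<lambda>i. (X i, f i)) ` I) (\<lambda>p. F (fst p)) snd"
    using * unfolding final_sink_def by simp
  then show "\<exists>(I :: ('d \<times> 'a) set) X f.
      (\<forall>i\<in>I. X i \<in> cob D) \<and> final_sink B E Y I (\<lambda>i. F (X i)) f"
    by blast
qed


section \<open>Quantaloids\<close>

record ('o, 'q) qtld = "('o, 'q) cat" +
  hle :: "'o \<Rightarrow> 'o \<Rightarrow> 'q \<Rightarrow> 'q \<Rightarrow> bool"

definition hlat :: "('o, 'q) qtld \<Rightarrow> 'o \<Rightarrow> 'o \<Rightarrow> 'q gorder" where
  "hlat Q S T = \<lparr>carrier = homs Q S T, eq = (=), le = hle Q S T\<rparr>"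

locale quantaloid = category Q for Q :: "('o, 'q) qtld" +
  assumes hom_complete_lattice: "\<lbrakk>S \<in> ob Q; T \<in> ob Q\<rbrakk> \<Longrightarrow> complete_lattice (hlat Q S T)"
    and cmp_Sup_left: "\<lbrakk>S \<in> ob Q; T \<in> ob Q; U \<in> ob Q; u \<in> homs Q S T; A \<subseteq> homs Q T U\<rbrakk>
      \<Longrightarrow> cmp Q S T U (\<Squnion>\<^bsub>hlat Q T U\<^esub> A) u = \<Squnion>\<^bsub>hlat Q S U\<^esub> ((\<lambda>v. cmp Q S T U v u) ` A)"
    and cmp_Sup_right: "\<lbrakk>S \<in> ob Q; T \<in> ob Q; U \<in> ob Q; v \<in> homs Q T U; A \<subseteq> homs Q S T\<rbrakk>
      \<Longrightarrow> cmp Q S T U v (\<Squnion>\<^bsub>hlat Q S T\<^esub> A) = \<Squnion>\<^bsub>hlat Q S U\<^esub> ((\<lambda>u. cmp Q S T U v u) ` A)"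

text \<open>
  For \<open>u : S \<rightarrow> T\<close>, \<open>v : T \<rightarrow> U\<close>, \<open>w : S \<rightarrow> U\<close>: \<open>limp Q S T U w u\<close> is
  \<open>w \<swarrow> u : T \<rightarrow> U\<close> and \<open>rimp Q S T U v w\<close> is \<open>v \<searrow> w : S \<rightarrow> T\<close>.
  The lemmas \<open>limp_adjoint\<close> and \<open>rimp_adjoint\<close> show that the descriptions are proper.
\<close>

definition limp :: "('o, 'q) qtld \<Rightarrow> 'o \<Rightarrow> 'o \<Rightarrow> 'o \<Rightarrow> 'q \<Rightarrow> 'q \<Rightarrow> 'q" where
  "limp Q S T U w u = (THE x. x \<in> homs Q T U \<and>
    (\<forall>v\<in>homs Q T U. hle Q S U (cmp Q S T U v u) w \<longleftrightarrow> hle Q T U v x))"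

definition rimp :: "('o, 'q) qtld \<Rightarrow> 'o \<Rightarrow> 'o \<Rightarrow> 'o \<Rightarrow> 'q \<Rightarrow> 'q \<Rightarrow> 'q" where
  "rimp Q S T U v w = (THE x. x \<in> homs Q S T \<and>
    (\<forall>u\<in>homs Q S T. hle Q S U (cmp Q S T U v u) w \<longleftrightarrow> hle Q S T u x))"

lemma sup_preserving_adjoint:
  assumes K: "complete_lattice K" and L: "complete_lattice L"
    and \<phi>: "\<phi> \<in> carrier K \<rightarrow> carrier L"
    and pres: "\<And>A. A \<subseteq> carrier K \<Longrightarrow> \<phi> (\<Squnion>\<^bsub>K\<^esub> A) = \<Squnion>\<^bsub>L\<^esub> (\<phi> ` A)"
    and w: "w \<in> carrier L"
  shows "\<exists>!x. x \<in> carrier K \<and> (\<forall>v\<in>carrier K. \<phi> v \<sqsubseteq>\<^bsub>L\<^esub> w \<longleftrightarrow> v \<sqsubseteq>\<^bsub>K\<^esub> x)"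
proof -
  interpret K: complete_lattice K by (rule K)
  interpret L: complete_lattice L by (rule L)
  have \<phi>c: "\<phi> a \<in> carrier L" if "a \<in> carrier K" for a
    using \<phi> that by auto
  have mono: "\<phi> a \<sqsubseteq>\<^bsub>L\<^esub> \<phi> b" if "a \<sqsubseteq>\<^bsub>K\<^esub> b" "a \<in> carrier K" "b \<in> carrier K" for a b
  proof -
    have "\<Squnion>\<^bsub>K\<^esub> {a, b} = b"
    proof (rule K.le_antisym)
      show "\<Squnion>\<^bsub>K\<^esub> {a, b} \<sqsubseteq>\<^bsub>K\<^esub> b" by (rule K.sup_least) (use that in auto)
      show "b \<sqsubseteq>\<^bsub>K\<^esub> \<Squnion>\<^bsub>K\<^esub> {a, b}" by (rule K.sup_upper) (use that in auto)
    qed (use that in auto)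
    then have "\<phi> b = \<Squnion>\<^bsub>L\<^esub> (\<phi> ` {a, b})"
      using pres[of "{a, b}"] that by simp
    moreover have "\<phi> a \<sqsubseteq>\<^bsub>L\<^esub> \<Squnion>\<^bsub>L\<^esub> (\<phi> ` {a, b})"
      by (rule L.sup_upper) (use that \<phi>c in auto)
    ultimately show ?thesis by simp
  qed
  let ?A = "{v \<in> carrier K. \<phi> v \<sqsubseteq>\<^bsub>L\<^esub> w}"
  let ?x = "\<Squnion>\<^bsub>K\<^esub> ?A"
  have xc: "?x \<in> carrier K" by (rule K.sup_closed) auto
  have "\<phi> ?x = \<Squnion>\<^bsub>L\<^esub> (\<phi> ` ?A)" by (rule pres) auto
  moreover have "\<Squnion>\<^bsub>L\<^esub> (\<phi> ` ?A) \<sqsubseteq>\<^bsub>L\<^esub> w"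
    by (rule L.sup_least) (use w \<phi>c in auto)
  ultimately have xw: "\<phi> ?x \<sqsubseteq>\<^bsub>L\<^esub> w" by simp
  have *: "\<phi> v \<sqsubseteq>\<^bsub>L\<^esub> w \<longleftrightarrow> v \<sqsubseteq>\<^bsub>K\<^esub> ?x" if v: "v \<in> carrier K" for v
  proof
    assume "\<phi> v \<sqsubseteq>\<^bsub>L\<^esub> w"
    then show "v \<sqsubseteq>\<^bsub>K\<^esub> ?x" by (intro K.sup_upper) (use v in auto)
  next
    assume "v \<sqsubseteq>\<^bsub>K\<^esub> ?x"
    then show "\<phi> v \<sqsubseteq>\<^bsub>L\<^esub> w"
      using mono[OF _ v xc] xw L.le_trans[of "\<phi> v" "\<phi> ?x" w] \<phi>c v xc w by auto
  qed
  show ?thesis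
  proof (rule ex1I[of _ ?x])
    show "?x \<in> carrier K \<and> (\<forall>v\<in>carrier K. \<phi> v \<sqsubseteq>\<^bsub>L\<^esub> w \<longleftrightarrow> v \<sqsubseteq>\<^bsub>K\<^esub> ?x)"
      using xc * by blast
  next
    fix y assume y: "y \<in> carrier K \<and> (\<forall>v\<in>carrier K. \<phi> v \<sqsubseteq>\<^bsub>L\<^esub> w \<longleftrightarrow> v \<sqsubseteq>\<^bsub>K\<^esub> y)"
    show "y = ?x"
    proof (rule K.le_antisym)
      show "y \<sqsubseteq>\<^bsub>K\<^esub> ?x" using y * K.refl[of y] by blast
      show "?x \<sqsubseteq>\<^bsub>K\<^esub> y" using y xc xw by blast
    qed (use y xc in auto)
  qed
qed

lemma (in quantaloid) limp_adjoint:
  assumes "S \<in> ob Q" "T \<in> ob Q" "U \<in> ob Q" "u \<in> homs Q S T" "w \<in> homs Q S U"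
  shows "limp Q S T U w u \<in> homs Q T U"
    and "v \<in> homs Q T U \<Longrightarrow>
      hle Q S U (cmp Q S T U v u) w \<longleftrightarrow> hle Q T U v (limp Q S T U w u)"
proof -
  have "\<exists>!x. x \<in> homs Q T U \<and>
      (\<forall>v\<in>homs Q T U. hle Q S U (cmp Q S T U v u) w \<longleftrightarrow> hle Q T U v x)"
    using sup_preserving_adjoint[of "hlat Q T U" "hlat Q S U" "\<lambda>v. cmp Q S T U v u" w]
      hom_complete_lattice cmp_Sup_left cmp_closed assms
    by (simp add: hlat_def Pi_def)
  from theI'[OF this] show "limp Q S T U w u \<in> homs Q T U"
    and "v \<in> homs Q T U \<Longrightarrow>
      hle Q S U (cmp Q S T U v u) w \<longleftrightarrow> hle Q T U v (limp Q S T U w u)"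
    unfolding limp_def by blast+
qed

lemma (in quantaloid) rimp_adjoint:
  assumes "S \<in> ob Q" "T \<in> ob Q" "U \<in> ob Q" "v \<in> homs Q T U" "w \<in> homs Q S U"
  shows "rimp Q S T U v w \<in> homs Q S T"
    and "u \<in> homs Q S T \<Longrightarrow>
      hle Q S U (cmp Q S T U v u) w \<longleftrightarrow> hle Q S T u (rimp Q S T U v w)"
proof -
  have "\<exists>!x. x \<in> homs Q S T \<and>
      (\<forall>u\<in>homs Q S T. hle Q S U (cmp Q S T U v u) w \<longleftrightarrow> hle Q S T u x)"
    using sup_preserving_adjoint[of "hlat Q S T" "hlat Q S U" "\<lambda>u. cmp Q S T U v u" w]
      hom_complete_lattice cmp_Sup_right cmp_closed assms
    by (simp add: hlat_def Pi_def)
  from theI'[OF this] show "rimp Q S T U v w \<in> homs Q S T"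
    and "u \<in> homs Q S T \<Longrightarrow>
      hle Q S U (cmp Q S T U v u) w \<longleftrightarrow> hle Q S T u (rimp Q S T U v w)"
    unfolding rimp_def by blast+
qed

definition free_quantaloid :: "('o, 'a) cat \<Rightarrow> ('o, 'a set) qtld" where
  "free_quantaloid B = \<lparr>
    ob = ob B,
    homs = (\<lambda>S T. Pow (homs B S T)),
    idt = (\<lambda>S. {idt B S}),
    cmp = (\<lambda>S T U G F. {cmp B S T U g f | f g. f \<in> F \<and> g \<in> G}),
    hle = (\<lambda>S T. (\<subseteq>))\<rparr>"

lemma Sup_powerset_lattice:
  assumes "\<A> \<subseteq> Pow A"
  shows "\<Squnion>\<^bsub>\<lparr>carrier = Pow A, eq = (=), le = (\<subseteq>)\<rparr>\<^esub> \<A> = \<Union>\<A>" (is "\<Squnion>\<^bsub>?L\<^esub> _ = _")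
proof -
  interpret complete_lattice ?L by (rule powerset_is_complete_lattice)
  show ?thesis
  proof
    show "\<Squnion>\<^bsub>?L\<^esub> \<A> \<subseteq> \<Union>\<A>"
      using sup_least[of \<A> "\<Union>\<A>"] assms by auto
    show "\<Union>\<A> \<subseteq> \<Squnion>\<^bsub>?L\<^esub> \<A>"
      using sup_upper[of \<A>] assms by auto
  qed
qed

lemma quantaloid_free_quantaloid:
  assumes "category B"
  shows "quantaloid (free_quantaloid B)"
proof -
  interpret category B by (rule assms)
  have hlat: "hlat (free_quantaloid B) S T =
      \<lparr>carrier = Pow (homs B S T), eq = (=), le = (\<subseteq>)\<rparr>" for S T
    by (simp add: hlat_def free_quantaloid_def)
  have ob: "ob (free_quantaloid B) = ob B"
    and homs: "homs (free_quantaloid B) S T = Pow (homs B S T)"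
    and idt: "idt (free_quantaloid B) S = {idt B S}"
    and cmp: "cmp (free_quantaloid B) S T U v u = {cmp B S T U g f | f g. f \<in> u \<and> g \<in> v}"
    for S T U u v
    by (simp_all add: free_quantaloid_def)
  have closed: "cmp (free_quantaloid B) S T U v u \<subseteq> homs B S U"
    if "S \<in> ob B" "T \<in> ob B" "U \<in> ob B" "u \<subseteq> homs B S T" "v \<subseteq> homs B T U" for S T U u v
    unfolding cmp using that cmp_closed by blast
  have "category (free_quantaloid B)"
  proof (rule category.intro, unfold ob homs Pow_iff)
    fix S assume "S \<in> ob B"
    then show "idt (free_quantaloid B) S \<subseteq> homs B S S"
      using idt_closed by (simp add: idt)
  next
    fix S T U u v
    assume "S \<in> ob B" "T \<in> ob B" "U \<in> ob B" "u \<subseteq> homs B S T" "v \<subseteq> homs B T U"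
    then show "cmp (free_quantaloid B) S T U v u \<subseteq> homs B S U"
      by (rule closed)
  next
    fix S T u
    assume *: "S \<in> ob B" "T \<in> ob B" "u \<subseteq> homs B S T"
    have r: "cmp B S S T f (idt B S) = f" and l: "cmp B S T T (idt B T) f = f" if "f \<in> u" for f
      using that * by (auto intro!: idt_right idt_left)
    have "cmp (free_quantaloid B) S S T u (idt (free_quantaloid B) S)
        = (\<lambda>f. cmp B S S T f (idt B S)) ` u"
      unfolding cmp idt by blast
    also have "\<dots> = u"
      using r by (simp cong: image_cong)
    finally show "cmp (free_quantaloid B) S S T u (idt (free_quantaloid B) S) = u" .
    have "cmp (free_quantaloid B) S T T (idt (free_quantaloid B) T) u
        = (\<lambda>f. cmp B S T T (idt B T) f) ` u"
      unfolding cmp idt by blast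
    also have "\<dots> = u"
      using l by (simp cong: image_cong)
    finally show "cmp (free_quantaloid B) S T T (idt (free_quantaloid B) T) u = u" .
  next
    fix S T U V u v w
    assume *: "S \<in> ob B" "T \<in> ob B" "U \<in> ob B" "V \<in> ob B"
      "u \<subseteq> homs B S T" "v \<subseteq> homs B T U" "w \<subseteq> homs B U V"
    have assoc: "cmp B S T V (cmp B T U V h g) f = cmp B S U V h (cmp B S T U g f)"
      if "f \<in> u" "g \<in> v" "h \<in> w" for f g h
      using that * by (intro cmp_assoc) auto
    have "cmp (free_quantaloid B) S T V (cmp (free_quantaloid B) T U V w v) u
        = {cmp B S T V (cmp B T U V h g) f | f g h. f \<in> u \<and> g \<in> v \<and> h \<in> w}"
      unfolding cmp by blast
    also have "\<dots> = {cmp B S U V h (cmp B S T U g f) | f g h. f \<in> u \<and> g \<in> v \<and> h \<in> w}"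
      using assoc by (intro Collect_cong ex_cong1) metis
    also have "\<dots> = cmp (free_quantaloid B) S U V w (cmp (free_quantaloid B) S T U v u)"
      unfolding cmp by blast
    finally show "cmp (free_quantaloid B) S T V (cmp (free_quantaloid B) T U V w v) u
        = cmp (free_quantaloid B) S U V w (cmp (free_quantaloid B) S T U v u)" .
  qed
  then show ?thesis
  proof (rule quantaloid.intro, intro quantaloid_axioms.intro, unfold ob homs hlat)
    fix S T
    show "complete_lattice \<lparr>carrier = Pow (homs B S T), eq = (=), le = (\<subseteq>)\<rparr>"
      by (rule powerset_is_complete_lattice)
  next
    fix S T U u A
    assume *: "S \<in> ob B" "T \<in> ob B" "U \<in> ob B" "u \<in> Pow (homs B S T)" "A \<subseteq> Pow (homs B T U)"
    have im: "(\<lambda>v. cmp (free_quantaloid B) S T U v u) ` A \<subseteq> Pow (homs B S U)"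
      by (rule image_subsetI, rule PowI, rule closed) (use * in auto)
    have "cmp (free_quantaloid B) S T U (\<Union>A) u
        = \<Union>((\<lambda>v. cmp (free_quantaloid B) S T U v u) ` A)"
      unfolding cmp by auto
    then show "cmp (free_quantaloid B) S T U
          (\<Squnion>\<^bsub>\<lparr>carrier = Pow (homs B T U), eq = (=), le = (\<subseteq>)\<rparr>\<^esub> A) u
        = \<Squnion>\<^bsub>\<lparr>carrier = Pow (homs B S U), eq = (=), le = (\<subseteq>)\<rparr>\<^esub>
            ((\<lambda>v. cmp (free_quantaloid B) S T U v u) ` A)"
      unfolding Sup_powerset_lattice[OF *(5)] Sup_powerset_lattice[OF im] .
  next
    fix S T U v A
    assume *: "S \<in> ob B" "T \<in> ob B" "U \<in> ob B" "v \<in> Pow (homs B T U)" "A \<subseteq> Pow (homs B S T)"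
    have im: "(\<lambda>u. cmp (free_quantaloid B) S T U v u) ` A \<subseteq> Pow (homs B S U)"
      by (rule image_subsetI, rule PowI, rule closed) (use * in auto)
    have "cmp (free_quantaloid B) S T U v (\<Union>A)
        = \<Union>((\<lambda>u. cmp (free_quantaloid B) S T U v u) ` A)"
      unfolding cmp by auto
    then show "cmp (free_quantaloid B) S T U v
          (\<Squnion>\<^bsub>\<lparr>carrier = Pow (homs B S T), eq = (=), le = (\<subseteq>)\<rparr>\<^esub> A)
        = \<Squnion>\<^bsub>\<lparr>carrier = Pow (homs B S U), eq = (=), le = (\<subseteq>)\<rparr>\<^esub>
            ((\<lambda>u. cmp (free_quantaloid B) S T U v u) ` A)"
      unfolding Sup_powerset_lattice[OF *(5)] Sup_powerset_lattice[OF im] .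
  qed
qed


section \<open>Categories enriched in a quantaloid\<close>

record ('e, 'o, 'q) qcat =
  qob :: "'e set"
  qext :: "'e \<Rightarrow> 'o"
  qhom :: "'e \<Rightarrow> 'e \<Rightarrow> 'q"

locale q_category = quantaloid Q
  for Q :: "('o, 'q) qtld" and E :: "('e, 'o, 'q) qcat" +
  assumes qext_closed: "X \<in> qob E \<Longrightarrow> qext E X \<in> ob Q"
    and qhom_closed: "\<lbrakk>X \<in> qob E; Y \<in> qob E\<rbrakk> \<Longrightarrow> qhom E X Y \<in> homs Q (qext E X) (qext E Y)"
    and qhom_idt: "X \<in> qob E \<Longrightarrow> hle Q (qext E X) (qext E X) (idt Q (qext E X)) (qhom E X X)"
    and qhom_cmp: "\<lbrakk>X \<in> qob E; Y \<in> qob E; Z \<in> qob E\<rbrakk> \<Longrightarrow> hle Q (qext E X) (qext E Z)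
      (cmp Q (qext E X) (qext E Y) (qext E Z) (qhom E Y Z) (qhom E X Y)) (qhom E X Z)"

definition q_functor ::
  "('o, 'q) qtld \<Rightarrow> ('d, 'o, 'q) qcat \<Rightarrow> ('e, 'o, 'q) qcat \<Rightarrow> ('d \<Rightarrow> 'e) \<Rightarrow> bool" where
  "q_functor Q D E F \<longleftrightarrow>
    (\<forall>X\<in>qob D. F X \<in> qob E \<and> qext E (F X) = qext D X) \<and>
    (\<forall>X\<in>qob D. \<forall>Y\<in>qob D. hle Q (qext D X) (qext D Y) (qhom D X Y) (qhom E (F X) (F Y)))"

definition q_sink :: "('o, 'q) qtld \<Rightarrow> ('d, 'o, 'q) qcat \<Rightarrow> 'o \<Rightarrow> ('d \<Rightarrow> 'q) \<Rightarrow> bool" where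
  "q_sink Q D T \<sigma> \<longleftrightarrow> T \<in> ob Q \<and> (\<forall>X\<in>qob D. \<sigma> X \<in> homs Q (qext D X) T)"

definition q_source :: "('o, 'q) qtld \<Rightarrow> ('d, 'o, 'q) qcat \<Rightarrow> 'o \<Rightarrow> ('d \<Rightarrow> 'q) \<Rightarrow> bool" where
  "q_source Q D T \<tau> \<longleftrightarrow> T \<in> ob Q \<and> (\<forall>X\<in>qob D. \<tau> X \<in> homs Q T (qext D X))"

text \<open>The meets are taken in the hom-lattice, so an empty meet is its top element.\<close>

definition is_colimit :: "('o, 'q) qtld \<Rightarrow> ('d, 'o, 'q) qcat \<Rightarrow> ('e, 'o, 'q) qcat \<Rightarrow>
    ('d \<Rightarrow> 'e) \<Rightarrow> 'o \<Rightarrow> ('d \<Rightarrow> 'q) \<Rightarrow> 'e \<Rightarrow> bool" where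
  "is_colimit Q D E F T \<sigma> C \<longleftrightarrow> C \<in> qob E \<and> qext E C = T \<and>
    (\<forall>Y\<in>qob E. qhom E C Y =
      (IINF\<^bsub>hlat Q T (qext E Y)\<^esub> X:qob D.
        limp Q (qext D X) T (qext E Y) (qhom E (F X) Y) (\<sigma> X)))"

definition is_limit :: "('o, 'q) qtld \<Rightarrow> ('d, 'o, 'q) qcat \<Rightarrow> ('e, 'o, 'q) qcat \<Rightarrow>
    ('d \<Rightarrow> 'e) \<Rightarrow> 'o \<Rightarrow> ('d \<Rightarrow> 'q) \<Rightarrow> 'e \<Rightarrow> bool" where
  "is_limit Q D E F T \<tau> C \<longleftrightarrow> C \<in> qob E \<and> qext E C = T \<and>
    (\<forall>Y\<in>qob E. qhom E Y C =
      (IINF\<^bsub>hlat Q (qext E Y) T\<^esub> X:qob D.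
        rimp Q (qext E Y) T (qext D X) (\<tau> X) (qhom E Y (F X))))"

definition dense :: "('o, 'q) qtld \<Rightarrow> ('d, 'o, 'q) qcat \<Rightarrow> ('e, 'o, 'q) qcat \<Rightarrow>
    ('d \<Rightarrow> 'e) \<Rightarrow> bool" where
  "dense Q D E F \<longleftrightarrow>
    (\<forall>C\<in>qob E. \<exists>T \<sigma>. q_sink Q D T \<sigma> \<and> is_colimit Q D E F T \<sigma> C)"

definition codense :: "('o, 'q) qtld \<Rightarrow> ('d, 'o, 'q) qcat \<Rightarrow> ('e, 'o, 'q) qcat \<Rightarrow>
    ('d \<Rightarrow> 'e) \<Rightarrow> bool" where
  "codense Q D E F \<longleftrightarrow>
    (\<forall>C\<in>qob E. \<exists>T \<tau>. q_source Q D T \<tau> \<and> is_limit Q D E F T \<tau> C)"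

text \<open>
  Concrete categories over \<open>B\<close> as categories enriched in the free quantaloid on \<open>B\<close>.  A concrete
  functor and the corresponding enriched functor have the same underlying object function.
\<close>

definition qcat_of :: "('e, 'o, 'a) concrete_cat \<Rightarrow> ('e, 'o, 'a set) qcat" where
  "qcat_of E = \<lparr>qob = cob E, qext = cext E, qhom = cmor E\<rparr>"

lemma q_category_qcat_of:
  assumes "concrete_category B E"
  shows "q_category (free_quantaloid B) (qcat_of E)"
proof -
  interpret concrete_category B E by (rule assms)
  interpret Q: quantaloid "free_quantaloid B"
    by (rule quantaloid_free_quantaloid) (rule category_axioms)
  show ?thesis
    by unfold_locales
      (use cext_closed cmor_subset cmor_idt cmor_cmp in
        \<open>auto simp: free_quantaloid_def qcat_of_def subset_iff\<close>)
qed

lemma q_functor_iff_concrete_functor: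
  "q_functor (free_quantaloid B) (qcat_of D) (qcat_of E) F \<longleftrightarrow> concrete_functor D E F"
  by (simp add: q_functor_def concrete_functor_def free_quantaloid_def qcat_of_def)

end

theory Submission
  imports Defs
begin

text \<open>
  A weight on \<open>D\<close> with values in the free quantaloid assigns to every object \<open>X\<close> of \<open>D\<close> a set of
  maps \<open>T \<rightarrow> |X|\<close>.  It is therefore nothing but a family of maps, namely the family indexed by all
  pairs \<open>(X, g)\<close> with \<open>g \<in> \<tau> X\<close> (\<open>weight_pairs\<close>).  Implications in the free quantaloid are
  \<open>\<tau> \<searrow> w = {f. \<forall>g\<in>\<tau>. g \<circ> f \<in> w}\<close> (\<open>rimp_free_quantaloid\<close>) and meets are intersections, so
  the equation that makes \<open>C\<close> the limit of \<open>F\<close> weighted by \<open>\<tau>\<close> says: a map \<open>f : |Z| \<rightarrow> |C|\<close> is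
  a morphism precisely if all composites \<open>g \<circ> f : Z \<rightarrow> F X\<close> are.  One half of this is the initiality
  condition.  The other half says that all \<open>g : C \<rightarrow> F X\<close> are themselves morphisms: evaluate it at
  the identity of \<open>C\<close> for one direction, compose for the other.  Hence a limit weighted by \<open>\<tau>\<close>
  is the same as an initial source given by the family of \<open>\<tau>\<close>
  (\<open>is_limit_iff_initial_source\<close>).

  Conversely every family arises in this way up to reindexing: initiality depends only on which pairs
  \<open>(X i, g i)\<close> occur, so the maps with the same target \<open>X\<close> may be collected into one set
  (\<open>initially_dense_iff_codense\<close>).

  The statement on final sinks is the same statement over the opposite base category.
\<close>

lemma free_quantaloid_simps [simp]:
  "ob (free_quantaloid B) = ob B"
  "homs (free_quantaloid B) S T = Pow (homs B S T)"
  "cmp (free_quantaloid B) S T U G H = {cmp B S T U g f | f g. f \<in> H \<and> g \<in> G}"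
  "hle (free_quantaloid B) S T = (\<subseteq>)"
  by (simp_all add: free_quantaloid_def)

lemma qcat_of_simps [simp]:
  "qob (qcat_of E) = cob E" "qext (qcat_of E) = cext E" "qhom (qcat_of E) = cmor E"
  by (simp_all add: qcat_of_def)

lemma hlat_free_quantaloid:
  "hlat (free_quantaloid B) S T = \<lparr>carrier = Pow (homs B S T), eq = (=), le = (\<subseteq>)\<rparr>"
  by (simp add: hlat_def)

lemma rimp_free_quantaloid:
  "rimp (free_quantaloid B) S T U v w = {f \<in> homs B S T. \<forall>g\<in>v. cmp B S T U g f \<in> w}"
  unfolding rimp_def
proof (rule the_equality, goal_cases)
  case 1
  show ?case by auto
next
  case (2 x)
  then have x: "x \<subseteq> homs B S T"
    and adj: "\<And>u. u \<subseteq> homs B S T \<Longrightarrow> (\<forall>f\<in>u. \<forall>g\<in>v. cmp B S T U g f \<in> w) \<longleftrightarrow> u \<subseteq> x"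
    by (simp_all, blast)
  \<comment> \<open>Singletons \<open>u\<close> already determine the set \<open>x\<close> by the adjunction.\<close>
  have "f \<in> x \<longleftrightarrow> (\<forall>g\<in>v. cmp B S T U g f \<in> w)" if "f \<in> homs B S T" for f
    using adj[of "{f}"] that by simp
  with x show ?case by blast
qed

text \<open>
  Intersecting with \<open>A\<close> accounts for the empty meet, which is the top element \<open>A\<close>.
\<close>

lemma Inf_powerset_lattice:
  assumes "\<A> \<subseteq> Pow A"
  shows "\<Sqinter>\<^bsub>\<lparr>carrier = Pow A, eq = (=), le = (\<subseteq>)\<rparr>\<^esub> \<A> = A \<inter> \<Inter>\<A>" (is "\<Sqinter>\<^bsub>?L\<^esub> _ = _")
proof -
  interpret complete_lattice ?L by (rule powerset_is_complete_lattice)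
  show ?thesis
  proof
    show "\<Sqinter>\<^bsub>?L\<^esub> \<A> \<subseteq> A \<inter> \<Inter>\<A>"
      using inf_lower[of \<A>] inf_closed[of \<A>] assms by auto
    show "A \<inter> \<Inter>\<A> \<subseteq> \<Sqinter>\<^bsub>?L\<^esub> \<A>"
      using inf_greatest[of \<A> "A \<inter> \<Inter>\<A>"] assms by auto
  qed
qed

lemma is_limit_free_quantaloid:
  "is_limit (free_quantaloid B) (qcat_of D) (qcat_of E) F T \<tau> C \<longleftrightarrow>
    C \<in> cob E \<and> cext E C = T \<and>
    (\<forall>Z\<in>cob E. cmor E Z C = {f \<in> homs B (cext E Z) T.
      \<forall>X\<in>cob D. \<forall>g\<in>\<tau> X. cmp B (cext E Z) T (cext D X) g f \<in> cmor E Z (F X)})"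
proof -
  have "(IINF\<^bsub>hlat (free_quantaloid B) S T\<^esub> X:cob D.
      rimp (free_quantaloid B) S T (cext D X) (\<tau> X) (cmor E Z (F X)))
    = {f \<in> homs B S T. \<forall>X\<in>cob D. \<forall>g\<in>\<tau> X. cmp B S T (cext D X) g f \<in> cmor E Z (F X)}" for S Z
    unfolding hlat_free_quantaloid rimp_free_quantaloid
    unfolding infi_def by (subst Inf_powerset_lattice) auto
  then show ?thesis
    by (simp add: is_limit_def)
qed

definition weight_pairs :: "('d, 'o, 'a) concrete_cat \<Rightarrow> ('d \<Rightarrow> 'a set) \<Rightarrow> ('d \<times> 'a) set" where
  "weight_pairs D \<tau> = Sigma (cob D) \<tau>"

text \<open>
  Of the equation that defines the limit, the inclusion from right to left is initiality verbatim.
  The other inclusion says that each \<open>g\<close> of the weight sends morphisms into \<open>C\<close> to morphisms by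
  composition, which amounts to \<open>g\<close> itself being a morphism out of \<open>C\<close>.
\<close>

lemma is_limit_iff_initial_source:
  assumes "concrete_category B E" and F: "concrete_functor D E F"
    and src: "q_source (free_quantaloid B) (qcat_of D) T \<tau>"
  shows "is_limit (free_quantaloid B) (qcat_of D) (qcat_of E) F T \<tau> C \<longleftrightarrow>
    cext E C = T \<and> initial_source B E C (weight_pairs D \<tau>) (\<lambda>p. F (fst p)) snd"
proof -
  interpret concrete_category B E by (rule assms(1))
  have FD: "F X \<in> cob E" "cext E (F X) = cext D X" if "X \<in> cob D" for X
    using F that by (auto simp: concrete_functor_def)
  have \<tau>: "g \<in> homs B T (cext D X)" if "X \<in> cob D" "g \<in> \<tau> X" for X g
    using src that by (auto simp: q_source_def)
  let ?lifts = "\<lambda>Z f. \<forall>X\<in>cob D. \<forall>g\<in>\<tau> X. cmp B (cext E Z) T (cext D X) g f \<in> cmor E Z (F X)"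
  have sub: "cmor E Z C \<subseteq> {f \<in> homs B (cext E Z) T. ?lifts Z f}"
    if mor: "\<forall>X\<in>cob D. \<forall>g\<in>\<tau> X. g \<in> cmor E C (F X)"
      and C: "C \<in> cob E" "cext E C = T" and Z: "Z \<in> cob E" for Z
  proof -
    have "cmp B (cext E Z) T (cext D X) g f \<in> cmor E Z (F X)"
      if "f \<in> cmor E Z C" "X \<in> cob D" "g \<in> \<tau> X" for f X g
      using cmor_cmp[OF Z C(1), of "F X" f g] that mor C FD[of X] by auto
    then show ?thesis
      using cmor_subset[OF Z C(1)] C by auto
  qed
  \<comment> \<open>As in the Yoneda lemma, it suffices to test at the identity of \<open>C\<close>.\<close>
  have mor: "\<forall>X\<in>cob D. \<forall>g\<in>\<tau> X. g \<in> cmor E C (F X)"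
    if "\<forall>Z\<in>cob E. cmor E Z C \<subseteq> {f \<in> homs B (cext E Z) T. ?lifts Z f}" "C \<in> cob E" "cext E C = T"
  proof (intro ballI)
    fix X g assume X: "X \<in> cob D" "g \<in> \<tau> X"
    have "cmp B T T (cext D X) g (idt B T) \<in> cmor E C (F X)"
      using that cmor_idt[of C] X by auto
    then show "g \<in> cmor E C (F X)"
      using idt_right \<tau>[OF X] cext_closed[of C] cext_closed[of "F X"] FD[of X] X that by simp
  qed
  have "initial_source B E C (weight_pairs D \<tau>) (\<lambda>p. F (fst p)) snd \<longleftrightarrow>
      C \<in> cob E \<and> (\<forall>X\<in>cob D. \<forall>g\<in>\<tau> X. g \<in> cmor E C (F X)) \<and>
      (\<forall>Z\<in>cob E. {f \<in> homs B (cext E Z) T. ?lifts Z f} \<subseteq> cmor E Z C)"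
    if "cext E C = T"
    using that FD by (auto simp: initial_source_def weight_pairs_def)
  then show ?thesis
    unfolding is_limit_free_quantaloid using sub mor by blast
qed

text \<open>
  The universal property quantifies over the members of the family, so repetitions and the choice of
  index set do not matter.
\<close>

lemma initial_source_reindex:
  "initial_source B E Y I (\<lambda>i. F (X i)) g \<longleftrightarrow>
    initial_source B E Y ((\<lambda>i. (X i, g i)) ` I) (\<lambda>p. F (fst p)) snd"
  by (simp add: initial_source_def)

lemma initially_dense_iff_codense:
  fixes B :: "('o, 'a) cat" and D :: "('d, 'o, 'a) concrete_cat"
  assumes "concrete_category B E" and F: "concrete_functor D E F"
  shows "initially_dense B D E F \<longleftrightarrow>
    codense (free_quantaloid B) (qcat_of D) (qcat_of E) F"
proof
  interpret concrete_category B E by (rule assms(1))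
  assume dense: "initially_dense B D E F"
  show "codense (free_quantaloid B) (qcat_of D) (qcat_of E) F"
    unfolding codense_def qcat_of_simps
  proof
    fix C assume C: "C \<in> cob E"
    with dense obtain I :: "('d \<times> 'a) set" and X g
      where X: "\<forall>i\<in>I. X i \<in> cob D" and init: "initial_source B E C I (\<lambda>i. F (X i)) g"
      unfolding initially_dense_def by blast
    \<comment> \<open>A family may contain several maps to the same \<open>W\<close>, or none; a weight has one set for each.\<close>
    define \<tau> where "\<tau> W = g ` {i \<in> I. X i = W}" for W
    have pairs: "weight_pairs D \<tau> = (\<lambda>i. (X i, g i)) ` I"
      using X by (auto simp: weight_pairs_def \<tau>_def)
    have "g i \<in> homs B (cext E C) (cext D (X i))" if "i \<in> I" for i
      using init that X C F cmor_subset[of C "F (X i)"]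
      by (auto simp: initial_source_def concrete_functor_def)
    then have src: "q_source (free_quantaloid B) (qcat_of D) (cext E C) \<tau>"
      using cext_closed[OF C] by (auto simp: q_source_def \<tau>_def)
    have "is_limit (free_quantaloid B) (qcat_of D) (qcat_of E) F (cext E C) \<tau> C"
      using is_limit_iff_initial_source[OF assms src] init
      by (simp add: pairs initial_source_reindex[symmetric])
    with src show "\<exists>T \<tau>. q_source (free_quantaloid B) (qcat_of D) T \<tau> \<and>
        is_limit (free_quantaloid B) (qcat_of D) (qcat_of E) F T \<tau> C"
      by blast
  qed
next
  assume codense: "codense (free_quantaloid B) (qcat_of D) (qcat_of E) F"
  show "initially_dense B D E F"
    unfolding initially_dense_def
  proof
    fix C assume "C \<in> cob E"
    with codense obtain T \<tau> where src: "q_source (free_quantaloid B) (qcat_of D) T \<tau>"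
      and "is_limit (free_quantaloid B) (qcat_of D) (qcat_of E) F T \<tau> C"
      by (auto simp: codense_def)
    then have "initial_source B E C (weight_pairs D \<tau>) (\<lambda>p. F (fst p)) snd"
      using is_limit_iff_initial_source[OF assms src] by blast
    moreover have "\<forall>p\<in>weight_pairs D \<tau>. fst p \<in> cob D"
      by (auto simp: weight_pairs_def)
    ultimately show "\<exists>(I :: ('d \<times> 'a) set) X g.
        (\<forall>i\<in>I. X i \<in> cob D) \<and> initial_source B E C I (\<lambda>i. F (X i)) g"
      by blast
  qed
qed

definition op_cat :: "('o, 'a) cat \<Rightarrow> ('o, 'a) cat" where
  "op_cat B = \<lparr>ob = ob B, homs = (\<lambda>S T. homs B T S), idt = idt B,
    cmp = (\<lambda>S T U g f. cmp B U T S f g)\<rparr>"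

definition op_concrete :: "('e, 'o, 'a) concrete_cat \<Rightarrow> ('e, 'o, 'a) concrete_cat" where
  "op_concrete E = \<lparr>cob = cob E, cext = cext E, cmor = (\<lambda>X Y. cmor E Y X)\<rparr>"

lemma op_cat_simps [simp]:
  "ob (op_cat B) = ob B" "homs (op_cat B) S T = homs B T S" "idt (op_cat B) = idt B"
  "cmp (op_cat B) S T U g f = cmp B U T S f g"
  by (simp_all add: op_cat_def)

lemma op_concrete_simps [simp]:
  "cob (op_concrete E) = cob E" "cext (op_concrete E) = cext E"
  "cmor (op_concrete E) X Y = cmor E Y X"
  by (simp_all add: op_concrete_def)

lemma concrete_category_op:
  assumes "concrete_category B E"
  shows "concrete_category (op_cat B) (op_concrete E)"
proof -
  interpret concrete_category B E by (rule assms)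
  show ?thesis
    by unfold_locales
      (use idt_closed cmp_closed idt_right idt_left cmp_assoc
          cext_closed cmor_subset cmor_idt cmor_cmp in simp_all)
qed

lemma concrete_functor_op:
  "concrete_functor D E F \<Longrightarrow> concrete_functor (op_concrete D) (op_concrete E) F"
  by (simp add: concrete_functor_def)

lemma finally_dense_iff_initially_dense_op:
  "finally_dense B D E F \<longleftrightarrow> initially_dense (op_cat B) (op_concrete D) (op_concrete E) F"
  by (simp add: finally_dense_def initially_dense_def final_sink_def initial_source_def)

text \<open>
  Passing to the opposite category reverses composition, which exchanges the two implications.
\<close>

lemma limp_eq_rimp_op:
  "limp (free_quantaloid B) S T U w u = rimp (free_quantaloid (op_cat B)) U T S u w"
proof -
  have "{cmp B S T U g f | f g. f \<in> u \<and> g \<in> v} = {cmp B S T U f g | f g. f \<in> v \<and> g \<in> u}" for v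
    by blast
  then show ?thesis
    by (simp add: limp_def rimp_def)
qed

lemma dense_iff_codense_op:
  "dense (free_quantaloid B) (qcat_of D) (qcat_of E) F \<longleftrightarrow>
    codense (free_quantaloid (op_cat B)) (qcat_of (op_concrete D)) (qcat_of (op_concrete E)) F"
  by (simp add: dense_def codense_def q_sink_def q_source_def is_colimit_def is_limit_def
      hlat_free_quantaloid limp_eq_rimp_op)

theorem proposition4p7:
  fixes B :: "('o, 'a) cat"
    and D :: "('d, 'o, 'a) concrete_cat"
    and E :: "('e, 'o, 'a) concrete_cat"
    and F :: "'d \<Rightarrow> 'e"
  assumes "category B"
    and "concrete_category B D"
    and "concrete_category B E"
    and "concrete_functor D E F"
  shows "(initially_dense B D E F \<longleftrightarrow>
          codense (free_quantaloid B) (qcat_of D) (qcat_of E) F) \<and>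
         (finally_dense B D E F \<longleftrightarrow>
          dense (free_quantaloid B) (qcat_of D) (qcat_of E) F)"
proof
  show "initially_dense B D E F \<longleftrightarrow> codense (free_quantaloid B) (qcat_of D) (qcat_of E) F"
    using assms(3,4) by (rule initially_dense_iff_codense)
  show "finally_dense B D E F \<longleftrightarrow> dense (free_quantaloid B) (qcat_of D) (qcat_of E) F"
    unfolding finally_dense_iff_initially_dense_op dense_iff_codense_op
    using assms(3,4)
    by (intro initially_dense_iff_codense concrete_category_op concrete_functor_op)
qed

end
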